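(* Let $(\mathfrak g,d_{\mathfrak g})$ be a differential 3-Lie algebra with weight $\lambda$ and $(V,d_V)$ an abelian differential 3-Lie algebra (trivial bracket). Let $0\to(V,d_V)\xrightarrow{i}(\hat{\mathfrak g},d_{\hat{\mathfrak g}})\xrightarrow{p}(\mathfrak g,d_{\mathfrak g})\to0$ be an abelian extension of $(\mathfrak g,d_{\mathfrak g})$ by $(V,d_V)$, let $s:\mathfrak g\to\hat{\mathfrak g}$ be a linear section of $p$, and define $\rho:\mathfrak g\wedge\mathfrak g\to gl(V)$ by $\rho(x,y)v=[s(x),s(y),v]_{\hat{\mathfrak g}}$ (identifying $V$ with $i(V)$). Then $(V,\rho,d_V)$ is a representation of $(\mathfrak g,d_{\mathfrak g})$ and it is independent of the choice of the section $s$. Furthermore, equivalent abelian extensions give the same representation.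
   Context: $k$ is a field of characteristic 0; all vector spaces are over $k$. A 3-Lie algebra is a vector space $\mathfrak g$ with a skew-symmetric trilinear bracket satisfying $[x_1,x_2,[y_1,y_2,y_3]]=[[x_1,x_2,y_1],y_2,y_3]+[y_1,[x_1,x_2,y_2],y_3]+[y_1,y_2,[x_1,x_2,y_3]]$. A differential 3-Lie algebra with weight $\lambda$ is a 3-Lie algebra with a linear map $d=d_{\mathfrak g}:\mathfrak g\to\mathfrak g$ such that $d[x_1,x_2,x_3]=[dx_1,x_2,x_3]+[x_1,dx_2,x_3]+[x_1,x_2,dx_3]+\lambda[dx_1,dx_2,x_3]+\lambda[x_1,dx_2,dx_3]+\lambda[dx_1,x_2,dx_3]+\lambda^2[dx_1,dx_2,dx_3]$. Homomorphisms of differential 3-Lie algebras are linear maps preserving brackets and commuting with the operators $d$. A representation of a 3-Lie algebra $\mathfrak g$ is a vector space $V$ with a skew-symmetric bilinear map $\rho:\mathfrak g\wedge\mathfrak g\to gl(V)$ such that $\rho(x_1,x_2)\rho(x_3,x_4)=\rho([x_1,x_2,x_3],x_4)+\rho(x_3,[x_1,x_2,x_4])+\rho(x_3,x_4)\rho(x_1,x_2)$ and $\rho(x_1,[x_2,x_3,x_4])=\rho(x_3,x_4)\rho(x_1,x_2)-\rho(x_2,x_4)\rho(x_1,x_3)+\rho(x_2,x_3)\rho(x_1,x_4)$. A representation $(V,\rho,d_V)$ of $(\mathfrak g,d)$ has in addition a linear $d_V:V\to V$ with $d_V\rho(x_1,x_2)=\rho(dx_1,x_2)+\rho(x_1,dx_2)+\lambda\rho(dx_1,dx_2)+\rho(x_1,x_2)d_V+\lambda(\rho(dx_1,x_2)+\rho(x_1,dx_2)+\lambda\rho(dx_1,dx_2))d_V$.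 An abelian extension of $(\mathfrak g,d_{\mathfrak g})$ by $(V,d_V)$ is an exact sequence of differential 3-Lie algebras (of weight $\lambda$) $0\to(V,d_V)\xrightarrow{i}(\hat{\mathfrak g},d_{\hat{\mathfrak g}})\xrightarrow{p}(\mathfrak g,d_{\mathfrak g})\to0$ such that $[V,V,\hat{\mathfrak g}]=[V,\hat{\mathfrak g},V]=[\hat{\mathfrak g},V,V]=0$. Two abelian extensions $\hat{\mathfrak g}_1,\hat{\mathfrak g}_2$ are equivalent if there is a homomorphism of differential 3-Lie algebras $\varphi:(\hat{\mathfrak g}_1,d_{\hat{\mathfrak g}_1})\to(\hat{\mathfrak g}_2,d_{\hat{\mathfrak g}_2})$ commuting with the inclusions of $V$ and the projections to $\mathfrak g$. *)

theory Defs
  imports Complex_Main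
begin

text \<open>
  A vector space over \<open>'k\<close> is a type of class \<^class>\<open>ab_group_add\<close> with a scalar multiplication
  satisfying \<^locale>\<open>vector_space\<close>. The qualified name \<open>Vector_Spaces.linear\<close> is linearity over an
  arbitrary field; the unqualified one is linearity over the reals.
\<close>

text \<open>
  Skew-symmetry is required for the two adjacent transpositions, which generate the symmetric
  group on three letters.
\<close>

locale three_lie_algebra = vector_space scale
  for scale :: "'k::field_char_0 \<Rightarrow> 'g::ab_group_add \<Rightarrow> 'g" +
  fixes br :: "'g \<Rightarrow> 'g \<Rightarrow> 'g \<Rightarrow> 'g"
  assumes br_linear1: "Vector_Spaces.linear scale scale (\<lambda>x. br x y z)"
    and br_linear2: "Vector_Spaces.linear scale scale (\<lambda>y. br x y z)"
    and br_linear3: "Vector_Spaces.linear scale scale (\<lambda>z. br x y z)"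
    and br_skew12: "br y x z = - br x y z"
    and br_skew23: "br x z y = - br x y z"
    and fundamental_identity:
      "br x1 x2 (br y1 y2 y3) =
         br (br x1 x2 y1) y2 y3 + br y1 (br x1 x2 y2) y3 + br y1 y2 (br x1 x2 y3)"

locale diff_three_lie_algebra = three_lie_algebra scale br
  for scale :: "'k::field_char_0 \<Rightarrow> 'g::ab_group_add \<Rightarrow> 'g"
    and br :: "'g \<Rightarrow> 'g \<Rightarrow> 'g \<Rightarrow> 'g" +
  fixes lam :: 'k
    and d :: "'g \<Rightarrow> 'g"
  assumes d_linear: "Vector_Spaces.linear scale scale d"
    and d_bracket:
      "d (br x1 x2 x3) =
         br (d x1) x2 x3 + br x1 (d x2) x3 + br x1 x2 (d x3)
         + scale lam (br (d x1) (d x2) x3)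
         + scale lam (br x1 (d x2) (d x3))
         + scale lam (br (d x1) x2 (d x3))
         + scale (lam ^ 2) (br (d x1) (d x2) (d x3))"

definition diff_three_lie_hom ::
  "('k::field_char_0 \<Rightarrow> 'a::ab_group_add \<Rightarrow> 'a) \<Rightarrow> ('a \<Rightarrow> 'a \<Rightarrow> 'a \<Rightarrow> 'a) \<Rightarrow> ('a \<Rightarrow> 'a) \<Rightarrow>
   ('k \<Rightarrow> 'b::ab_group_add \<Rightarrow> 'b) \<Rightarrow> ('b \<Rightarrow> 'b \<Rightarrow> 'b \<Rightarrow> 'b) \<Rightarrow> ('b \<Rightarrow> 'b) \<Rightarrow>
   ('a \<Rightarrow> 'b) \<Rightarrow> bool"
  where "diff_three_lie_hom scaleA brA dA scaleB brB dB f \<longleftrightarrow>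
    Vector_Spaces.linear scaleA scaleB f \<and>
    (\<forall>x y z. f (brA x y z) = brB (f x) (f y) (f z)) \<and>
    (\<forall>x. f (dA x) = dB (f x))"

locale three_lie_rep =
  G: three_lie_algebra scaleG brG + V: vector_space scaleV
  for scaleG :: "'k::field_char_0 \<Rightarrow> 'g::ab_group_add \<Rightarrow> 'g"
    and brG :: "'g \<Rightarrow> 'g \<Rightarrow> 'g \<Rightarrow> 'g"
    and scaleV :: "'k \<Rightarrow> 'v::ab_group_add \<Rightarrow> 'v" +
  fixes rho :: "'g \<Rightarrow> 'g \<Rightarrow> 'v \<Rightarrow> 'v"
  assumes rho_endo: "Vector_Spaces.linear scaleV scaleV (rho x y)"
    and rho_linear1: "Vector_Spaces.linear scaleG scaleV (\<lambda>x. rho x y v)"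
    and rho_linear2: "Vector_Spaces.linear scaleG scaleV (\<lambda>y. rho x y v)"
    and rho_skew: "rho y x v = - rho x y v"
    and rho_commutator:
      "rho x1 x2 (rho x3 x4 v) =
         rho (brG x1 x2 x3) x4 v + rho x3 (brG x1 x2 x4) v + rho x3 x4 (rho x1 x2 v)"
    and rho_bracket:
      "rho x1 (brG x2 x3 x4) v =
         rho x3 x4 (rho x1 x2 v) - rho x2 x4 (rho x1 x3 v) + rho x2 x3 (rho x1 x4 v)"

locale diff_three_lie_rep =
  diff_three_lie_algebra scaleG brG lam dG + three_lie_rep scaleG brG scaleV rho
  for scaleG :: "'k::field_char_0 \<Rightarrow> 'g::ab_group_add \<Rightarrow> 'g"
    and brG :: "'g \<Rightarrow> 'g \<Rightarrow> 'g \<Rightarrow> 'g"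
    and lam :: 'k
    and dG :: "'g \<Rightarrow> 'g"
    and scaleV :: "'k \<Rightarrow> 'v::ab_group_add \<Rightarrow> 'v"
    and rho :: "'g \<Rightarrow> 'g \<Rightarrow> 'v \<Rightarrow> 'v" +
  fixes dV :: "'v \<Rightarrow> 'v"
  assumes dV_linear: "Vector_Spaces.linear scaleV scaleV dV"
    and dV_rho:
      "dV (rho x1 x2 v) =
         rho (dG x1) x2 v + rho x1 (dG x2) v + scaleV lam (rho (dG x1) (dG x2) v)
         + rho x1 x2 (dV v)
         + scaleV lam
             (rho (dG x1) x2 (dV v) + rho x1 (dG x2) (dV v)
              + scaleV lam (rho (dG x1) (dG x2) (dV v)))"

definition trivial_bracket :: "'v \<Rightarrow> 'v \<Rightarrow> 'v \<Rightarrow> 'v::zero"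
  where "trivial_bracket u v w = 0"

locale abelian_extension =
  G: diff_three_lie_algebra scaleG brG lam dG +
  V: diff_three_lie_algebra scaleV trivial_bracket lam dV +
  E: diff_three_lie_algebra scaleE brE lam dE
  for lam :: "'k::field_char_0"
    and scaleG :: "'k \<Rightarrow> 'g::ab_group_add \<Rightarrow> 'g"
    and brG :: "'g \<Rightarrow> 'g \<Rightarrow> 'g \<Rightarrow> 'g"
    and dG :: "'g \<Rightarrow> 'g"
    and scaleV :: "'k \<Rightarrow> 'v::ab_group_add \<Rightarrow> 'v"
    and dV :: "'v \<Rightarrow> 'v"
    and scaleE :: "'k \<Rightarrow> 'e::ab_group_add \<Rightarrow> 'e"
    and brE :: "'e \<Rightarrow> 'e \<Rightarrow> 'e \<Rightarrow> 'e"
    and dE :: "'e \<Rightarrow> 'e" +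
  fixes i :: "'v \<Rightarrow> 'e"
    and p :: "'e \<Rightarrow> 'g"
  assumes i_hom: "diff_three_lie_hom scaleV trivial_bracket dV scaleE brE dE i"
    and p_hom: "diff_three_lie_hom scaleE brE dE scaleG brG dG p"
    and exact_V: "inj i"
    and exact_E: "range i = {e. p e = 0}"
    and exact_G: "surj p"
    and br_VVE: "brE (i u) (i v) e = 0"
    and br_VEV: "brE (i u) e (i v) = 0"
    and br_EVV: "brE e (i u) (i v) = 0"

definition equivalent_extensions ::
  "('k::field_char_0 \<Rightarrow> 'e::ab_group_add \<Rightarrow> 'e) \<Rightarrow> ('e \<Rightarrow> 'e \<Rightarrow> 'e \<Rightarrow> 'e) \<Rightarrow> ('e \<Rightarrow> 'e) \<Rightarrow>
   ('v \<Rightarrow> 'e) \<Rightarrow> ('e \<Rightarrow> 'g) \<Rightarrow>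
   ('k \<Rightarrow> 'f::ab_group_add \<Rightarrow> 'f) \<Rightarrow> ('f \<Rightarrow> 'f \<Rightarrow> 'f \<Rightarrow> 'f) \<Rightarrow> ('f \<Rightarrow> 'f) \<Rightarrow>
   ('v \<Rightarrow> 'f) \<Rightarrow> ('f \<Rightarrow> 'g) \<Rightarrow> bool"
  where "equivalent_extensions scaleE brE dE i p scaleF brF dF j q \<longleftrightarrow>
    (\<exists>\<phi>. diff_three_lie_hom scaleE brE dE scaleF brF dF \<phi> \<and>
         (\<forall>v. \<phi> (i v) = j v) \<and> (\<forall>e. q (\<phi> e) = p e))"

definition linear_section ::
  "('k::field_char_0 \<Rightarrow> 'g::ab_group_add \<Rightarrow> 'g) \<Rightarrow> ('k \<Rightarrow> 'e::ab_group_add \<Rightarrow> 'e) \<Rightarrow>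
   ('e \<Rightarrow> 'g) \<Rightarrow> ('g \<Rightarrow> 'e) \<Rightarrow> bool"
  where "linear_section scaleG scaleE p s \<longleftrightarrow>
    Vector_Spaces.linear scaleG scaleE s \<and> (\<forall>x. p (s x) = x)"

text \<open>
  \<open>V\<close> is identified with its image under \<open>i\<close> by applying the inverse of \<open>i\<close>. That inverse is
  meaningful only on the range of \<open>i\<close>; that the bracket lies there is not part of the definition
  and has to be proved for an abelian extension.
\<close>

definition induced_rho ::
  "('e \<Rightarrow> 'e \<Rightarrow> 'e \<Rightarrow> 'e) \<Rightarrow> ('v \<Rightarrow> 'e) \<Rightarrow> ('g \<Rightarrow> 'e) \<Rightarrow> 'g \<Rightarrow> 'g \<Rightarrow> 'v \<Rightarrow> 'v"
  where "induced_rho brE i s x y v = inv i (brE (s x) (s y) (i v))"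

end

theory Submission
  imports Defs
begin

text \<open>
  Since brackets with two entries from \<open>V\<close> vanish, \<open>[e, f, v]\<close> depends on \<open>e\<close> and \<open>f\<close> only
  through \<open>p e\<close> and \<open>p f\<close>. Hence \<open>[e, f, i v] = i (\<rho> (p e) (p f) v)\<close> for arbitrary lifts
  \<open>e\<close>, \<open>f\<close>, which gives independence of the section and invariance under equivalence. As \<open>i\<close> is
  injective, the axioms of a representation can be checked in the extension, choosing as lifts
  brackets and derivatives of the values of \<open>s\<close>; there they follow from the fundamental
  identity and the compatibility of \<open>d\<close> with the bracket.
\<close>

context three_lie_algebra
begin

lemma br_add [simp]:
  "br (a + b) y z = br a y z + br b y z"
  "br x (a + b) z = br x a z + br x b z"
  "br x y (a + b) = br x y a + br x y b"
  using br_linear1 br_linear2 br_linear3 by (auto simp: Vector_Spaces.linear_iff)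

lemma br_scale [simp]:
  "br (scale c x) y z = scale c (br x y z)"
  "br x (scale c y) z = scale c (br x y z)"
  "br x y (scale c z) = scale c (br x y z)"
  using br_linear1 br_linear2 br_linear3 by (auto simp: Vector_Spaces.linear_iff)

lemma br_zero [simp]: "br 0 y z = 0" "br x 0 z = 0" "br x y 0 = 0"
  using br_add(1)[of 0 0 y z] br_add(2)[of x 0 0 z] br_add(3)[of x y 0 0] by simp_all

lemma br_minus [simp]:
  "br (- x) y z = - br x y z"
  "br x (- y) z = - br x y z"
  "br x y (- z) = - br x y z"
  using br_add(1)[of x "- x" y z] br_add(2)[of x y "- y" z] br_add(3)[of x y z "- z"]
  by (simp_all add: eq_neg_iff_add_eq_0 add.commute)

lemma br_rotate: "br z x y = br x y z"
  by (metis br_skew12 br_skew23 minus_minus)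

text \<open>This is the second representation axiom for the action of a 3-Lie algebra on itself by
  \<open>br x y\<close>. It comes from the fundamental identity once \<open>v\<close> is swapped
  into the second slot, so that \<open>br x1 v\<close> acts as a derivation on the inner
  bracket.\<close>

lemma bracket_action:
  "br x1 (br x2 x3 x4) v =
     br x3 x4 (br x1 x2 v) - br x2 x4 (br x1 x3 v) + br x2 x3 (br x1 x4 v)"
proof -
  have "br x1 (br x2 x3 x4) v = - br x1 v (br x2 x3 x4)"
    by (rule br_skew23)
  also have "br x1 v (br x2 x3 x4) =
      br (br x1 v x2) x3 x4 + br x2 (br x1 v x3) x4 + br x2 x3 (br x1 v x4)"
    by (rule fundamental_identity)
  \<comment> \<open>Returning \<open>v\<close> to the innermost last slot takes one sign in the
    outer two terms and two in the middle one, since rotations are even. With the sign of the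
    initial swap this gives the pattern plus, minus, plus.\<close>
  also have "br (br x1 v x2) x3 x4 = - br x3 x4 (br x1 x2 v)"
    by (simp add: br_rotate[of "br x1 x2 v"] br_skew23[of x1 v x2])
  also have "br x2 (br x1 v x3) x4 = br x2 x4 (br x1 x3 v)"
    by (simp add: br_skew23[of x2 "br x1 x3 v" x4] br_skew23[of x1 v x3])
  also have "br x2 x3 (br x1 v x4) = - br x2 x3 (br x1 x4 v)"
    by (simp add: br_skew23[of x1 v x4])
  finally show ?thesis
    by simp
qed

end

context abelian_extension
begin

lemma i_add: "i (u + v) = i u + i v"
  and i_scale: "i (scaleV c v) = scaleE c (i v)"
  and i_d: "i (dV v) = dE (i v)"
  using i_hom by (auto simp: diff_three_lie_hom_def Vector_Spaces.linear_iff)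

lemma p_add: "p (e + f) = p e + p f"
  and p_br: "p (brE e f g) = brG (p e) (p f) (p g)"
  and p_d: "p (dE e) = dG (p e)"
  using p_hom by (auto simp: diff_three_lie_hom_def Vector_Spaces.linear_iff)

lemma i_uminus: "i (- v) = - i v"
  using i_scale[of "- 1" v] by simp

lemma i_diff: "i (u - v) = i u - i v"
  using i_add[of u "- v"] by (simp add: i_uminus)

lemma p_i: "p (i v) = 0"
  using exact_E by blast

lemma same_fibre:
  assumes "p e = p e'"
  obtains u where "e = e' + i u"
proof -
  have "p (e - e') = 0"
    using p_add[of "e - e'" e'] assms by simp
  then obtain u where "e - e' = i u"
    using exact_E by blast
  then show thesis
    using that by (metis add.commute diff_add_cancel)
qed

lemma br_V_fibrewise:
  assumes "p e = p e'" "p f = p f'"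
  shows "brE e f (i v) = brE e' f' (i v)"
  using assms
  by (auto elim!: same_fibre simp: br_VVE br_VEV br_EVV)

text \<open>Here \<open>inv i\<close> becomes meaningful: \<open>p\<close> preserves brackets and
  kills \<open>i v\<close>, so the bracket lies in the kernel of \<open>p\<close>, which is the
  range of \<open>i\<close>.\<close>

lemma i_inv_br: "i (inv i (brE e f (i v))) = brE e f (i v)"
proof -
  have "p (brE e f (i v)) = 0"
    by (simp add: p_br p_i)
  then show ?thesis
    using exact_E by (metis (mono_tags) mem_Collect_eq f_inv_into_f)
qed

end

locale sectioned_abelian_extension = abelian_extension +
  fixes s
  assumes is_section: "linear_section scaleG scaleE p s"
begin

abbreviation rho where "rho \<equiv> induced_rho brE i s"

lemma p_s: "p (s x) = x"
  and s_add: "s (x + y) = s x + s y"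
  and s_scale: "s (scaleG c x) = scaleE c (s x)"
  using is_section by (auto simp: linear_section_def Vector_Spaces.linear_iff)

lemma i_rho: "i (rho x y v) = brE (s x) (s y) (i v)"
  by (simp add: induced_rho_def i_inv_br)

lemma i_rho_lift: "p e = x \<Longrightarrow> p f = y \<Longrightarrow> i (rho x y v) = brE e f (i v)"
  unfolding i_rho by (rule br_V_fibrewise) (simp_all add: p_s)

text \<open>A section is only linear, so it may fail to respect brackets and \<open>d\<close>. The
  defect lies in the kernel of \<open>p\<close>, however, and is invisible in a bracket with an
  entry from V. As rewrite rules these equations remove \<open>s\<close> from compound
  arguments.\<close>

lemma section_lifts:
  "brE (s (brG x y z)) f (i v) = brE (brE (s x) (s y) (s z)) f (i v)"
  "brE f (s (brG x y z)) (i v) = brE f (brE (s x) (s y) (s z)) (i v)"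
  "brE (s (dG x)) f (i v) = brE (dE (s x)) f (i v)"
  "brE f (s (dG x)) (i v) = brE f (dE (s x)) (i v)"
  by (rule br_V_fibrewise; simp add: p_br p_d p_s)+

lemma diff_rep: "diff_three_lie_rep scaleG brG lam dG scaleV rho dV"
proof (intro diff_three_lie_rep.intro three_lie_rep.intro three_lie_rep_axioms.intro
    diff_three_lie_rep_axioms.intro G.diff_three_lie_algebra_axioms
    G.three_lie_algebra_axioms V.vector_space_axioms)
  fix x y z w v
  note simps = i_rho i_add i_scale i_uminus s_add s_scale
  show "Vector_Spaces.linear scaleV scaleV (rho x y)"
    by (auto simp: Vector_Spaces.linear_iff V.vector_space_axioms simps intro!: injD[OF exact_V])
  show "Vector_Spaces.linear scaleG scaleV (\<lambda>x. rho x y v)"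
    "Vector_Spaces.linear scaleG scaleV (\<lambda>y. rho x y v)"
    by (auto simp: Vector_Spaces.linear_iff V.vector_space_axioms G.vector_space_axioms simps
        intro!: injD[OF exact_V])
  show "rho y x v = - rho x y v"
    by (rule injD[OF exact_V]) (simp add: simps E.br_skew12[of "s y"])
  \<comment> \<open>Under \<open>i\<close> this is the fundamental identity with \<open>i v\<close>
    as innermost last entry.\<close>
  show "rho x y (rho z w v) =
      rho (brG x y z) w v + rho z (brG x y w) v + rho z w (rho x y v)"
    by (rule injD[OF exact_V])
      (simp add: i_add i_rho section_lifts
        E.fundamental_identity[of "s x" "s y" "s z"])
  show "rho x (brG y z w) v = rho z w (rho x y v) - rho y w (rho x z v) + rho y z (rho x w v)"
    by (rule injD[OF exact_V])
      (simp add: i_add i_diff i_rho section_lifts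
        E.bracket_action[of "s x" "s y"])
  show "Vector_Spaces.linear scaleV scaleV dV"
    by (rule V.d_linear)
  show "dV (rho x y v) =
      rho (dG x) y v + rho x (dG y) v + scaleV lam (rho (dG x) (dG y) v) + rho x y (dV v)
      + scaleV lam (rho (dG x) y (dV v) + rho x (dG y) (dV v)
          + scaleV lam (rho (dG x) (dG y) (dV v)))"
    (is "_ = ?rhs")
  proof (rule injD[OF exact_V])
    \<comment> \<open>With \<open>dE\<close> outermost, \<open>i_rho\<close> first exposes a bracket
      on which \<open>E.d_bracket\<close> can act; only then does the reversed \<open>i_d\<close>
      turn \<open>dE (i v)\<close> into \<open>i (dV v)\<close>. The seven terms match, \<lambda>
      squared being two nested scalings.\<close>
    have "dE (i (rho x y v)) = i ?rhs"
      by (simp add: i_add i_scale i_rho section_lifts E.d_bracket E.scale_right_distrib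
          power2_eq_square algebra_simps flip: i_d)
    then show "i (dV (rho x y v)) = i ?rhs"
      by (simp only: i_d)
  qed
qed

end

text \<open>The sections \<open>s\<close> and \<open>t\<close> are unrelated, so this covers a
  change of section as well as a change of extension.\<close>

lemma induced_rho_equivalent:
  fixes scaleF :: "'k::field_char_0 \<Rightarrow> 'f::ab_group_add \<Rightarrow> 'f"
  assumes "abelian_extension lam scaleG brG dG scaleV dV scaleE brE dE i p"
    and "linear_section scaleG scaleE p s"
    and "abelian_extension lam scaleG brG dG scaleV dV scaleF brF dF j q"
    and "linear_section scaleG scaleF q t"
    and "equivalent_extensions scaleE brE dE i p scaleF brF dF j q"
  shows "induced_rho brF j t = induced_rho brE i s"
proof (intro ext)
  fix x y v
  interpret E: sectioned_abelian_extension lam scaleG brG dG scaleV dV scaleE brE dE i p s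
    using assms by (simp add: sectioned_abelian_extension_def sectioned_abelian_extension_axioms_def)
  interpret F: sectioned_abelian_extension lam scaleG brG dG scaleV dV scaleF brF dF j q t
    using assms by (simp add: sectioned_abelian_extension_def sectioned_abelian_extension_axioms_def)
  obtain \<phi> where \<phi>: "\<And>a b c. \<phi> (brE a b c) = brF (\<phi> a) (\<phi> b) (\<phi> c)"
      "\<And>v. \<phi> (i v) = j v" "\<And>e. q (\<phi> e) = p e"
    using assms(5) by (auto simp: equivalent_extensions_def diff_three_lie_hom_def)
  \<comment> \<open>Since \<open>q\<close> after \<phi> is \<open>p\<close>, the elements
    \<open>\<phi> (s x)\<close> and \<open>\<phi> (s y)\<close> are lifts of \<open>x\<close> and
    \<open>y\<close> and may replace \<open>t x\<close> and \<open>t y\<close>.\<close>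
  have "j (F.rho x y v) = brF (\<phi> (s x)) (\<phi> (s y)) (j v)"
    by (rule F.i_rho_lift) (simp_all add: \<phi>(3) E.p_s)
  also have "\<dots> = \<phi> (brE (s x) (s y) (i v))"
    by (simp add: \<phi>(1,2))
  also have "\<dots> = j (E.rho x y v)"
    by (simp add: \<phi>(2) flip: E.i_rho)
  finally show "F.rho x y v = E.rho x y v"
    by (rule injD[OF F.exact_V])
qed

text \<open>Comparing an extension with itself, under two different sections, yields independence of
  the section.\<close>

lemma equivalent_extensions_refl:
  assumes "abelian_extension lam scaleG brG dG scaleV dV scaleE brE dE i p"
  shows "equivalent_extensions scaleE brE dE i p scaleE brE dE i p"
proof -
  interpret abelian_extension lam scaleG brG dG scaleV dV scaleE brE dE i p
    by (rule assms)
  have "diff_three_lie_hom scaleE brE dE scaleE brE dE (\<lambda>e. e)"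
    by (simp add: diff_three_lie_hom_def Vector_Spaces.linear_iff E.vector_space_axioms)
  then show ?thesis
    unfolding equivalent_extensions_def by blast
qed

theorem theorem5p3:
  fixes lam :: "'k::field_char_0"
    and scaleG :: "'k \<Rightarrow> 'g::ab_group_add \<Rightarrow> 'g"
    and brG :: "'g \<Rightarrow> 'g \<Rightarrow> 'g \<Rightarrow> 'g"
    and dG :: "'g \<Rightarrow> 'g"
    and scaleV :: "'k \<Rightarrow> 'v::ab_group_add \<Rightarrow> 'v"
    and dV :: "'v \<Rightarrow> 'v"
    and scaleE :: "'k \<Rightarrow> 'e::ab_group_add \<Rightarrow> 'e"
    and brE :: "'e \<Rightarrow> 'e \<Rightarrow> 'e \<Rightarrow> 'e"
    and dE :: "'e \<Rightarrow> 'e"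
    and i :: "'v \<Rightarrow> 'e"
    and p :: "'e \<Rightarrow> 'g"
    and s :: "'g \<Rightarrow> 'e"
  assumes "diff_three_lie_algebra scaleG brG lam dG"
    and "diff_three_lie_algebra scaleV trivial_bracket lam dV"
    and "abelian_extension lam scaleG brG dG scaleV dV scaleE brE dE i p"
    and "linear_section scaleG scaleE p s"
  shows "(\<forall>x y v. i (induced_rho brE i s x y v) = brE (s x) (s y) (i v)) \<and>
    diff_three_lie_rep scaleG brG lam dG scaleV (induced_rho brE i s) dV \<and>
    (\<forall>s'. linear_section scaleG scaleE p s' \<longrightarrow>
       induced_rho brE i s' = induced_rho brE i s) \<and>
    (\<forall>(scaleF :: 'k \<Rightarrow> 'f::ab_group_add \<Rightarrow> 'f) brF dF j q t.
       abelian_extension lam scaleG brG dG scaleV dV scaleF brF dF j q \<longrightarrow>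
       equivalent_extensions scaleE brE dE i p scaleF brF dF j q \<longrightarrow>
       linear_section scaleG scaleF q t \<longrightarrow>
       induced_rho brF j t = induced_rho brE i s)"
proof -
  interpret sectioned_abelian_extension lam scaleG brG dG scaleV dV scaleE brE dE i p s
    using assms(3,4)
    by (simp add: sectioned_abelian_extension_def sectioned_abelian_extension_axioms_def)
  show ?thesis
    using i_rho diff_rep induced_rho_equivalent[OF assms(3,4)]
      induced_rho_equivalent[OF assms(3,4,3) _ equivalent_extensions_refl[OF assms(3)]]
    by blast
qed

end
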